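(* Suppose that $f\in C^2_p(\mathbb{R})$ satisfies $\lim_{|x|\to\infty}f(x)=+\infty$ and that $f$ is strictly convex. Let $(\mu(t),\sigma(t))$, $t\ge0$, solve the gradient flow $$\dot\mu=-\frac{\partial F}{\partial\mu}(\mu,\sigma),\qquad \dot\sigma=-\frac{\partial F}{\partial\sigma}(\mu,\sigma).$$ Then $\mu(t)\to\bar x$ as $t\to\infty$, where $\bar x$ is the unique minimizer of $f$.
   Context: $C^k_p(\mathbb{R})$ is the set of functions $f:\mathbb{R}\to\mathbb{R}$ with $k$ continuous derivatives such that for every $0\le j\le k$, $\lim_{|x|\to\infty}f^{(j)}(x)/|x|^m=0$ for some $m>0$. A $C^2$ function $f$ is called strictly convex if $f''(x)>0$ for all $x$. For $\mu\in\mathbb{R}$, $\sigma>0$, $\Gamma_{\mu,\sigma}(x)=\frac{1}{\sqrt{2\pi}\,\sigma}e^{-(x-\mu)^2/(2\sigma^2)}$ and $F(\mu,\sigma)=\int_{\mathbb{R}}f(x)\Gamma_{\mu,\sigma}(x)\,dx$. For $f\in C^2_p(\mathbb{R})$, $F$ and $\nabla F$ extend continuously to $\sigma=0$, and the flow is considered on $\{\sigma\ge0\}$. *)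

theory Defs
  imports "HOL-Probability.Probability"
begin

text \<open>The class \<open>C^k_p(\<real>)\<close>; the exponent \<open>m\<close> is a real number that may depend on \<open>j\<close>.\<close>

definition C_poly :: "nat \<Rightarrow> (real \<Rightarrow> real) set" where
  "C_poly k = {f.
     (\<forall>j<k. \<forall>x. (deriv ^^ j) f differentiable (at x)) \<and>
     (\<forall>j\<le>k. continuous_on UNIV ((deriv ^^ j) f)) \<and>
     (\<forall>j\<le>k. \<exists>m::real. m > 0 \<and>
        ((\<lambda>x. (deriv ^^ j) f x / \<bar>x\<bar> powr m) \<longlongrightarrow> 0) at_infinity)}"

text \<open>Only meant for \<open>C^2\<close> functions.\<close>

definition strictly_convex :: "(real \<Rightarrow> real) \<Rightarrow> bool" where
  "strictly_convex f \<longleftrightarrow> (\<forall>x. (deriv ^^ 2) f x > 0)"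

text \<open>For \<open>\<sigma> > 0\<close>, \<^const>\<open>normal_density\<close> is the Gaussian kernel
  \<open>\<Gamma>(x) = exp (-(x - \<mu>)^2 / (2 \<sigma>^2)) / (sqrt (2 \<pi>) \<sigma>)\<close>.\<close>

definition gauss_avg :: "(real \<Rightarrow> real) \<Rightarrow> real \<Rightarrow> real \<Rightarrow> real" where
  "gauss_avg f \<mu> \<sigma> = (\<integral>x. f x * normal_density \<mu> \<sigma> x \<partial>lborel)"

text \<open>The extension by continuity of a function on the open half plane \<open>\<sigma> > 0\<close> to the closed
  one, the limit at \<open>(\<mu>, 0)\<close> being taken jointly in both variables. Values for
  \<open>\<sigma> < 0\<close> are meaningless.\<close>

definition extend_halfplane :: "(real \<Rightarrow> real \<Rightarrow> real) \<Rightarrow> real \<Rightarrow> real \<Rightarrow> real" where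
  "extend_halfplane g \<mu> \<sigma> =
     (if \<sigma> > 0 then g \<mu> \<sigma> else Lim (at (\<mu>, \<sigma>) within UNIV \<times> {0<..}) (\<lambda>(m, s). g m s))"

definition gauss_avg_d\<mu> :: "(real \<Rightarrow> real) \<Rightarrow> real \<Rightarrow> real \<Rightarrow> real" where
  "gauss_avg_d\<mu> f = extend_halfplane (\<lambda>\<mu> \<sigma>. deriv (\<lambda>m. gauss_avg f m \<sigma>) \<mu>)"

definition gauss_avg_d\<sigma> :: "(real \<Rightarrow> real) \<Rightarrow> real \<Rightarrow> real \<Rightarrow> real" where
  "gauss_avg_d\<sigma> f = extend_halfplane (\<lambda>\<mu> \<sigma>. deriv (\<lambda>s. gauss_avg f \<mu> s) \<sigma>)"

text \<open>Solutions live in the closed half plane; the case \<open>\<sigma> = 0\<close> is allowed, also initially.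
  At \<open>t = 0\<close> the derivative is one-sided.\<close>

definition gradient_flow :: "(real \<Rightarrow> real) \<Rightarrow> (real \<Rightarrow> real) \<Rightarrow> (real \<Rightarrow> real) \<Rightarrow> bool" where
  "gradient_flow f \<mu> \<sigma> \<longleftrightarrow>
     (\<forall>t\<ge>0. \<sigma> t \<ge> 0 \<and>
        (\<mu> has_real_derivative - gauss_avg_d\<mu> f (\<mu> t) (\<sigma> t)) (at t within {0..}) \<and>
        (\<sigma> has_real_derivative - gauss_avg_d\<sigma> f (\<mu> t) (\<sigma> t)) (at t within {0..}))"

end

theory Submission
  imports Defs
begin

text \<open>
  With \<open>Z\<close> standard normal and \<open>X = \<mu> + \<sigma> Z\<close>, one has \<open>\<partial>F/\<partial>\<mu> = E f'(X)\<close> and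
  \<open>\<partial>F/\<partial>\<sigma> = E (Z f'(X))\<close>, and both expressions are continuous up to \<open>\<sigma> = 0\<close>. Hence along the flow
  \<open>V = ((\<mu> - xbar)^2 + \<sigma>^2) / 2\<close> satisfies \<open>V' = - E ((X - xbar) f'(X))\<close>. Since \<open>f'\<close> is strictly
  increasing and vanishes at \<open>xbar\<close>, the right-hand side is negative away from \<open>(xbar, 0)\<close>;
  being continuous, it is bounded away from \<open>0\<close> on compact annuli, which forces \<open>V\<close> to \<open>0\<close>.
\<close>

section \<open>Dominated convergence and differentiation under the integral\<close>

text \<open>Dominated convergence is a statement about sequences; in a first countable space a limit
  along \<open>at x within S\<close> can be tested on sequences in \<open>S - {x}\<close>.\<close>

lemma tendsto_integral_dominated_within:
  fixes k :: "'a::first_countable_topology \<Rightarrow> 'b \<Rightarrow> real"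
  assumes meas: "\<And>y. k y \<in> borel_measurable M" "l \<in> borel_measurable M"
    and w: "integrable M w"
    and bound: "\<forall>\<^sub>F y in at x within S. \<forall>z. \<bar>k y z\<bar> \<le> w z"
    and lim: "\<And>z. ((\<lambda>y. k y z) \<longlongrightarrow> l z) (at x within S)"
  shows "((\<lambda>y. \<integral>z. k y z \<partial>M) \<longlongrightarrow> (\<integral>z. l z \<partial>M)) (at x within S)"
  unfolding tendsto_at_iff_sequentially
proof (intro allI impI)
  fix X assume X: "\<forall>i. X i \<in> S - {x}" "X \<longlonglongrightarrow> x"
  then have fl: "filterlim X (at x within S) sequentially"
    by (auto simp: filterlim_at)
  obtain N where N: "\<And>i. i \<ge> N \<Longrightarrow> \<forall>z. \<bar>k (X i) z\<bar> \<le> w z"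
    using bound[THEN eventually_compose_filterlim, OF fl] by (auto simp: eventually_sequentially)
  \<comment> \<open>The bound holds only near \<open>x\<close>, hence only from index
    \<open>N\<close> on; shifting the sequence by \<open>N\<close> makes it hold for every
    term.\<close>
  have "(\<lambda>i. \<integral>z. k (X (i + N)) z \<partial>M) \<longlonglongrightarrow> (\<integral>z. l z \<partial>M)"
  proof (rule integral_dominated_convergence[where w = w])
    have "(\<lambda>i. k (X (i + N)) z) \<longlonglongrightarrow> l z" for z
      using LIMSEQ_ignore_initial_segment[OF filterlim_compose[OF lim fl, of z]] by simp
    then show "AE z in M. (\<lambda>i. k (X (i + N)) z) \<longlonglongrightarrow> l z" by simp
    show "AE z in M. norm (k (X (i + N)) z) \<le> w z" for i
      using N[of "i + N"] by simp
  qed (use meas w in auto)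
  then show "((\<lambda>y. \<integral>z. k y z \<partial>M) \<circ> X) \<longlonglongrightarrow> (\<integral>z. l z \<partial>M)"
    using LIMSEQ_offset[where f = "\<lambda>i. \<integral>z. k (X i) z \<partial>M"] by (simp add: comp_def)
qed

text \<open>By the mean value inequality, a bound \<open>w\<close> on \<open>k'\<close> near
  \<open>x\<close> also bounds the difference quotients, so dominated convergence applies to
  them.\<close>

lemma has_real_derivative_integral_dominated:
  fixes k k' :: "real \<Rightarrow> 'b \<Rightarrow> real"
  assumes int: "\<And>y. integrable M (k y)"
    and meas: "k' x \<in> borel_measurable M"
    and w: "integrable M w"
    and r: "r > 0"
    and der: "\<And>y z. ((\<lambda>y. k y z) has_real_derivative k' y z) (at y)"
    and bound: "\<And>y z. \<bar>y - x\<bar> < r \<Longrightarrow> \<bar>k' y z\<bar> \<le> w z"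
  shows "((\<lambda>y. \<integral>z. k y z \<partial>M) has_real_derivative (\<integral>z. k' x z \<partial>M)) (at x)"
proof -
  have quot: "\<bar>(k y z - k x z) / (y - x)\<bar> \<le> w z" if "\<bar>y - x\<bar> < r" "y \<noteq> x" for y z
  proof -
    have "norm (k y z - k x z) \<le> w z * norm (y - x)"
    proof (rule field_differentiable_bound[of "ball x r" "\<lambda>y. k y z" "\<lambda>y. k' y z"])
      show "((\<lambda>y. k y z) has_field_derivative k' u z) (at u within ball x r)" for u
        using der by (rule DERIV_subset) simp
      show "norm (k' u z) \<le> w z" if "u \<in> ball x r" for u
        using bound[of u z] that by (simp add: dist_real_def abs_minus_commute)
    qed (use that r in \<open>auto simp: dist_real_def abs_minus_commute\<close>)
    then show ?thesis using that by (simp add: field_simps)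
  qed
  have "((\<lambda>y. \<integral>z. (k y z - k x z) / (y - x) \<partial>M) \<longlongrightarrow> (\<integral>z. k' x z \<partial>M)) (at x)"
  proof (rule tendsto_integral_dominated_within[where w = w])
    have "\<forall>\<^sub>F y in at x. \<bar>y - x\<bar> < r \<and> y \<noteq> x"
      using r by (auto simp: eventually_at dist_real_def)
    then show "\<forall>\<^sub>F y in at x. \<forall>z. \<bar>(k y z - k x z) / (y - x)\<bar> \<le> w z"
      by eventually_elim (use quot in blast)
    show "((\<lambda>y. (k y z - k x z) / (y - x)) \<longlongrightarrow> k' x z) (at x)" for z
      using der[of z x] by (simp add: has_field_derivative_iff)
    show "(\<lambda>z. (k y z - k x z) / (y - x)) \<in> borel_measurable M" for y
      using int[of y] int[of x] by (auto dest!: borel_measurable_integrable)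
  qed (use meas w in auto)
  moreover have "(\<integral>z. (k y z - k x z) / (y - x) \<partial>M) = ((\<integral>z. k y z \<partial>M) - (\<integral>z. k x z \<partial>M)) / (y - x)" for y
    by (simp only: integral_divide_zero Bochner_Integration.integral_diff[OF int int])
  ultimately show ?thesis by (simp only: has_field_derivative_iff)
qed

section \<open>Gaussian averages of functions of polynomial growth\<close>

text \<open>A global bound with a natural exponent: it can be expanded binomially into Gaussian
  moments, and \<open>1 + \<bar>x\<bar>\<close> behaves well under affine substitutions.\<close>

definition poly_growth :: "(real \<Rightarrow> real) \<Rightarrow> bool" where
  "poly_growth g \<longleftrightarrow> (\<exists>C n. \<forall>x. \<bar>g x\<bar> \<le> C * (1 + \<bar>x\<bar>) ^ n)"

text \<open>Far out the limit gives a bound by \<open>\<bar>x\<bar> powr m\<close>, and on the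
  remaining compact interval continuity gives a constant \<open>B\<close>; the factor
  \<open>B + 1\<close> covers both regions.\<close>

lemma poly_growthI_tendsto:
  assumes cont: "continuous_on UNIV g"
    and lim: "((\<lambda>x. g x / \<bar>x\<bar> powr m) \<longlongrightarrow> 0) at_infinity"
  shows "poly_growth g"
proof -
  have "\<forall>\<^sub>F x in at_infinity. \<bar>g x / \<bar>x\<bar> powr m\<bar> < 1"
    using tendstoD[OF lim, of 1] by simp
  then obtain b where b: "\<And>x. \<bar>x\<bar> \<ge> b \<Longrightarrow> \<bar>g x / \<bar>x\<bar> powr m\<bar> < 1"
    by (auto simp: eventually_at_infinity)
  \<comment> \<open>Beyond \<open>R\<close> one has \<open>\<bar>x\<bar> > 1\<close>, so rounding
    the exponent \<open>m\<close> up to \<open>n\<close> only enlarges the power.\<close>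
  define R where "R = max b 1"
  have "bounded (g ` cball 0 R)"
    by (intro compact_imp_bounded compact_continuous_image continuous_on_subset[OF cont]) auto
  then obtain B where B: "\<And>x. \<bar>x\<bar> \<le> R \<Longrightarrow> \<bar>g x\<bar> \<le> B"
    unfolding bounded_iff by force
  have B0: "0 \<le> B"
    using B[of 0] unfolding R_def by linarith
  define n where "n = nat \<lceil>m\<rceil>"
  have "\<bar>g x\<bar> \<le> (B + 1) * (1 + \<bar>x\<bar>) ^ n" for x
  proof (cases "\<bar>x\<bar> \<le> R")
    case True
    have "\<bar>g x\<bar> \<le> (B + 1) * 1" using B[OF True] by simp
    also have "\<dots> \<le> (B + 1) * (1 + \<bar>x\<bar>) ^ n"
      using B0 by (intro mult_left_mono) auto
    finally show ?thesis .
  next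
    case False
    then have x: "\<bar>x\<bar> > 1" "\<bar>x\<bar> \<ge> b" by (auto simp: R_def)
    then have "\<bar>g x\<bar> \<le> \<bar>x\<bar> powr m"
      using b[of x] by (simp add: divide_less_eq split: if_splits)
    also have "\<dots> \<le> \<bar>x\<bar> powr (real n)"
      using x by (intro powr_mono) (auto simp: n_def real_nat_ceiling_ge)
    also have "\<dots> = \<bar>x\<bar> ^ n" using x by (simp add: powr_realpow)
    also have "\<dots> \<le> (1 + \<bar>x\<bar>) ^ n" by (intro power_mono) auto
    also have "\<dots> \<le> (B + 1) * (1 + \<bar>x\<bar>) ^ n" using B0 by (simp add: algebra_simps)
    finally show ?thesis .
  qed
  then show ?thesis unfolding poly_growth_def by blast
qed

lemma integrable_gaussian_poly:
  "integrable lborel (\<lambda>z. c * (1 + \<bar>z\<bar>) ^ n * std_normal_density z)"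
proof -
  have "(\<lambda>z. c * (1 + \<bar>z\<bar>) ^ n * std_normal_density z) =
      (\<lambda>z. \<Sum>k\<le>n. c * (real (n choose k) * (std_normal_density z * \<bar>z\<bar> ^ (n - k))))"
    by (simp add: binomial_ring sum_distrib_left sum_distrib_right mult_ac)
  then show ?thesis
    by (auto intro!: integrable_std_normal_moment_abs)
qed

text \<open>This is E (h(Z) g(\<mu> + \<sigma> Z)) with Z standard normal. The density is free of
  the parameters, so the formula makes sense for every real \<sigma>, in particular at 0. The
  weights \<open>1\<close> and \<open>z\<close> yield the two partial derivatives.\<close>

definition gauss_mean :: "(real \<Rightarrow> real) \<Rightarrow> (real \<Rightarrow> real) \<Rightarrow> real \<Rightarrow> real \<Rightarrow> real" where
  "gauss_mean h g \<mu> \<sigma> = (\<integral>z. h z * g (\<mu> + \<sigma> * z) * std_normal_density z \<partial>lborel)"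

text \<open>Since \<open>1 + \<bar>m + s * z\<bar> \<le> (1 + A) * (1 + \<bar>z\<bar>)\<close>, the
  growth bound separates into a constant and a power of \<open>1 + \<bar>z\<bar>\<close>, and a
  single \<open>w\<close> serves a whole square of parameters. The condition on \<open>h\<close>
  admits both weights at the cost of one more power.\<close>

lemma poly_growth_affine_dominated:
  assumes "poly_growth g" and h: "\<And>z. \<bar>h z\<bar> \<le> 1 + \<bar>z\<bar>"
  obtains w where "integrable lborel w"
    "\<And>m s z. \<bar>m\<bar> \<le> A \<Longrightarrow> \<bar>s\<bar> \<le> A \<Longrightarrow> \<bar>h z * g (m + s * z) * std_normal_density z\<bar> \<le> w z"
proof -
  obtain C n where C: "\<And>x. \<bar>g x\<bar> \<le> C * (1 + \<bar>x\<bar>) ^ n"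
    using assms(1) by (auto simp: poly_growth_def)
  have C0: "0 \<le> C" using C[of 0] by simp
  have "\<bar>h z * g (m + s * z) * std_normal_density z\<bar>
      \<le> C * (1 + A) ^ n * (1 + \<bar>z\<bar>) ^ Suc n * std_normal_density z"
    if A: "\<bar>m\<bar> \<le> A" "\<bar>s\<bar> \<le> A" for m s z
  proof -
    have "\<bar>m + s * z\<bar> \<le> A + A * \<bar>z\<bar>"
      using A by (intro order_trans[OF abs_triangle_ineq] add_mono) (auto simp: abs_mult intro: mult_right_mono)
    then have "1 + \<bar>m + s * z\<bar> \<le> (1 + A) * (1 + \<bar>z\<bar>)"
      by (simp add: algebra_simps)
    then have "(1 + \<bar>m + s * z\<bar>) ^ n \<le> ((1 + A) * (1 + \<bar>z\<bar>)) ^ n"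
      by (intro power_mono) auto
    then have "\<bar>g (m + s * z)\<bar> \<le> C * ((1 + A) * (1 + \<bar>z\<bar>)) ^ n"
      using C[of "m + s * z"] C0 by (meson mult_left_mono order_trans)
    then have "\<bar>h z\<bar> * \<bar>g (m + s * z)\<bar> \<le> (1 + \<bar>z\<bar>) * (C * ((1 + A) * (1 + \<bar>z\<bar>)) ^ n)"
      using h by (intro mult_mono) auto
    then have "\<bar>h z\<bar> * \<bar>g (m + s * z)\<bar> * std_normal_density z
        \<le> (1 + \<bar>z\<bar>) * (C * ((1 + A) * (1 + \<bar>z\<bar>)) ^ n) * std_normal_density z"
      by (rule mult_right_mono) simp
    then show ?thesis by (simp add: abs_mult power_mult_distrib mult_ac)
  qed
  then show ?thesis
    using that integrable_gaussian_poly by blast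
qed

section \<open>Continuity and derivatives of Gaussian means\<close>

lemma
  assumes g: "poly_growth g" "continuous_on UNIV g"
    and h: "h \<in> borel_measurable borel" "\<And>z. \<bar>h z\<bar> \<le> 1 + \<bar>z\<bar>"
  shows integrable_gauss_mean:
      "integrable lborel (\<lambda>z. h z * g (\<mu> + \<sigma> * z) * std_normal_density z)" (is ?int)
    and isCont_gauss_mean:
      "isCont (\<lambda>p. gauss_mean h g (fst p) (snd p)) (\<mu>, \<sigma>)" (is ?cont)
proof -
  \<comment> \<open>The summand 1 makes the square of side \<open>2 * A\<close> contain the unit
    ball around \<open>(\<mu>, \<sigma>)\<close>, so \<open>w\<close> dominates in a
    neighbourhood.\<close>
  define A where "A = max \<bar>\<mu>\<bar> \<bar>\<sigma>\<bar> + 1"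
  obtain w where w: "integrable lborel w"
    "\<And>m s z. \<bar>m\<bar> \<le> A \<Longrightarrow> \<bar>s\<bar> \<le> A \<Longrightarrow> \<bar>h z * g (m + s * z) * std_normal_density z\<bar> \<le> w z"
    using poly_growth_affine_dominated[OF g(1) h(2), of A] by auto
  have [measurable]: "g \<in> borel_measurable borel"
    using g(2) by (rule borel_measurable_continuous_onI)
  note h(1)[measurable]
  show ?int
    by (rule Bochner_Integration.integrable_bound[OF w(1)])
      (auto intro!: AE_I2 order_trans[OF w(2) abs_ge_self] simp: A_def)
  have gc: "isCont g x" for x
    using g(2) by (simp add: continuous_on_eq_continuous_at)
  have near: "\<forall>\<^sub>F p in at (\<mu>, \<sigma>). \<bar>fst p\<bar> \<le> A \<and> \<bar>snd p\<bar> \<le> A"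
  proof -
    have "\<forall>\<^sub>F p in at (\<mu>, \<sigma>). dist p (\<mu>, \<sigma>) < 1"
      by (auto simp: eventually_at intro!: exI[of _ 1])
    then show ?thesis
    proof eventually_elim
      case (elim p)
      have "dist (fst p) \<mu> < 1" "dist (snd p) \<sigma> < 1"
        using elim dist_fst_le[of p "(\<mu>, \<sigma>)"] dist_snd_le[of p "(\<mu>, \<sigma>)"] by auto
      then show ?case by (auto simp: A_def dist_real_def)
    qed
  qed
  show ?cont
    unfolding isCont_def gauss_mean_def
  proof (rule tendsto_integral_dominated_within[where w = w])
    show "\<forall>\<^sub>F p in at (\<mu>, \<sigma>). \<forall>z. \<bar>h z * g (fst p + snd p * z) * std_normal_density z\<bar> \<le> w z"
      using near by eventually_elim (use w(2) in blast)
    show "((\<lambda>p. h z * g (fst p + snd p * z) * std_normal_density z) \<longlongrightarrow>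
        h z * g (fst (\<mu>, \<sigma>) + snd (\<mu>, \<sigma>) * z) * std_normal_density z) (at (\<mu>, \<sigma>))" for z
      by (intro tendsto_intros isCont_tendsto_compose[OF gc])
  qed (use w in auto)
qed

text \<open>Differentiation under the integral; the inner derivative of
  \<open>\<mu> + \<sigma> * z\<close> is \<open>1\<close> in \<mu> and \<open>z\<close> in \<sigma>,
  which is where the two weights come from.\<close>

lemma
  assumes f: "poly_growth f" "continuous_on UNIV f" "\<And>x. (f has_real_derivative g x) (at x)"
    and g: "poly_growth g" "continuous_on UNIV g"
  shows gauss_mean_has_derivative_mean:
      "((\<lambda>m. gauss_mean (\<lambda>_. 1) f m \<sigma>) has_real_derivative gauss_mean (\<lambda>_. 1) g \<mu> \<sigma>) (at \<mu>)"
    and gauss_mean_has_derivative_sd: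
      "((\<lambda>s. gauss_mean (\<lambda>_. 1) f \<mu> s) has_real_derivative gauss_mean (\<lambda>z. z) g \<mu> \<sigma>) (at \<sigma>)"
proof -
  define A where "A = max \<bar>\<mu>\<bar> \<bar>\<sigma>\<bar> + 1"
  have [measurable]: "g \<in> borel_measurable borel"
    using g(2) by (rule borel_measurable_continuous_onI)
  obtain w where w: "integrable lborel w"
    "\<And>m s z. \<bar>m\<bar> \<le> A \<Longrightarrow> \<bar>s\<bar> \<le> A \<Longrightarrow> \<bar>1 * g (m + s * z) * std_normal_density z\<bar> \<le> w z"
    using poly_growth_affine_dominated[OF g(1), of "\<lambda>_. 1" A] by auto
  show "((\<lambda>m. gauss_mean (\<lambda>_. 1) f m \<sigma>) has_real_derivative gauss_mean (\<lambda>_. 1) g \<mu> \<sigma>) (at \<mu>)"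
    unfolding gauss_mean_def
  proof (rule has_real_derivative_integral_dominated[where w = w and r = 1])
    show "((\<lambda>m. 1 * f (m + \<sigma> * z) * std_normal_density z) has_real_derivative
        1 * g (m + \<sigma> * z) * std_normal_density z) (at m)" for m z
      by (auto intro!: derivative_eq_intros DERIV_chain2[OF f(3)])
    show "\<bar>1 * g (m + \<sigma> * z) * std_normal_density z\<bar> \<le> w z" if "\<bar>m - \<mu>\<bar> < 1" for m z
      by (rule w(2)) (use that in \<open>auto simp: A_def\<close>)
  qed (use w in \<open>auto intro!: integrable_gauss_mean[OF f(1,2), of "\<lambda>_. 1", simplified]\<close>)
  obtain v where v: "integrable lborel v"
    "\<And>m s z. \<bar>m\<bar> \<le> A \<Longrightarrow> \<bar>s\<bar> \<le> A \<Longrightarrow> \<bar>z * g (m + s * z) * std_normal_density z\<bar> \<le> v z"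
    using poly_growth_affine_dominated[OF g(1), of "\<lambda>z. z" A] by auto
  show "((\<lambda>s. gauss_mean (\<lambda>_. 1) f \<mu> s) has_real_derivative gauss_mean (\<lambda>z. z) g \<mu> \<sigma>) (at \<sigma>)"
    unfolding gauss_mean_def
  proof (rule has_real_derivative_integral_dominated[where w = v and r = 1])
    show "((\<lambda>s. 1 * f (\<mu> + s * z) * std_normal_density z) has_real_derivative
        z * g (\<mu> + s * z) * std_normal_density z) (at s)" for s z
      by (auto intro!: derivative_eq_intros DERIV_chain2[OF f(3)])
    show "\<bar>z * g (\<mu> + s * z) * std_normal_density z\<bar> \<le> v z" if "\<bar>s - \<sigma>\<bar> < 1" for s z
      by (rule v(2)) (use that in \<open>auto simp: A_def\<close>)
  qed (use v in \<open>auto intro!: integrable_gauss_mean[OF f(1,2), of "\<lambda>_. 1", simplified]\<close>)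
qed

section \<open>The gradient on the closed half plane\<close>

text \<open>Substitution x = \<mu> + \<sigma> z; the Jacobian \<sigma> cancels the factor 1/\<sigma>
  of the density.\<close>

lemma gauss_avg_eq_gauss_mean:
  assumes "\<sigma> > 0"
  shows "gauss_avg f \<mu> \<sigma> = gauss_mean (\<lambda>_. 1) f \<mu> \<sigma>"
proof -
  have "gauss_avg f \<mu> \<sigma> = \<bar>\<sigma>\<bar> *\<^sub>R (\<integral>z. f (\<mu> + \<sigma> * z) * normal_density \<mu> \<sigma> (\<mu> + \<sigma> * z) \<partial>lborel)"
    unfolding gauss_avg_def using assms by (intro lborel_integral_real_affine) auto
  also have "\<dots> = (\<integral>z. \<sigma> * (f (\<mu> + \<sigma> * z) * normal_density \<mu> \<sigma> (\<mu> + \<sigma> * z)) \<partial>lborel)"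
    using assms by simp
  also have "\<dots> = gauss_mean (\<lambda>_. 1) f \<mu> \<sigma>"
    unfolding gauss_mean_def using assms
    by (intro Bochner_Integration.integral_cong)
      (auto simp: normal_density_def real_sqrt_mult power_mult_distrib field_simps)
  finally show ?thesis .
qed

text \<open>At a boundary point the limit of \<open>g\<close> is that of \<open>G\<close>, which
  continuity identifies. \<open>Lim\<close> is a definite description, so the limit must also be
  unique, that is, the point must be a limit point of the open half plane.\<close>

lemma extend_halfplane_eq:
  assumes eq: "\<And>m s. s > 0 \<Longrightarrow> g m s = G m s"
    and cont: "isCont (\<lambda>p. G (fst p) (snd p)) (\<mu>, \<sigma>)" and "\<sigma> \<ge> 0"
  shows "extend_halfplane g \<mu> \<sigma> = G \<mu> \<sigma>"
proof (cases "\<sigma> > 0")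
  case True
  then show ?thesis by (simp add: extend_halfplane_def eq)
next
  case False
  let ?S = "(UNIV :: real set) \<times> {0::real<..}"
  have "\<sigma> = 0" using False assms(3) by simp
  have "(\<mu>, \<sigma>) islimpt ?S"
  proof (rule islimptI)
    fix T :: "(real \<times> real) set" assume "(\<mu>, \<sigma>) \<in> T" "open T"
    then obtain e where e: "e > 0" "ball (\<mu>, \<sigma>) e \<subseteq> T" by (auto elim: openE)
    then have "(\<mu>, e / 2) \<in> T" by (auto simp: \<open>\<sigma> = 0\<close> dist_prod_def dist_real_def)
    then show "\<exists>y\<in>?S. y \<in> T \<and> y \<noteq> (\<mu>, \<sigma>)"
      using e \<open>\<sigma> = 0\<close> by (intro bexI[of _ "(\<mu>, e / 2)"]) auto
  qed
  then have nt: "at (\<mu>, \<sigma>) within ?S \<noteq> bot"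
    by (simp add: trivial_limit_within)
  have "((\<lambda>p. G (fst p) (snd p)) \<longlongrightarrow> G \<mu> \<sigma>) (at (\<mu>, \<sigma>) within ?S)"
    using cont by (auto simp: isCont_def intro: tendsto_within_subset)
  moreover have "\<forall>\<^sub>F p in at (\<mu>, \<sigma>) within ?S. G (fst p) (snd p) = (case p of (m, s) \<Rightarrow> g m s)"
    by (auto simp: eventually_at eq intro!: exI[of _ 1])
  ultimately have "((\<lambda>(m, s). g m s) \<longlongrightarrow> G \<mu> \<sigma>) (at (\<mu>, \<sigma>) within ?S)"
    by (rule Lim_transform_eventually)
  then show ?thesis
    using nt False by (simp add: extend_halfplane_def tendsto_Lim)
qed

text \<open>For \<sigma> > 0 the partial derivatives are Gaussian means of \<open>g\<close>, and the
  joint continuity of these carries the formulas over to \<sigma> = 0.\<close>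

lemma
  assumes f: "poly_growth f" "continuous_on UNIV f" "\<And>x. (f has_real_derivative g x) (at x)"
    and g: "poly_growth g" "continuous_on UNIV g" and "\<sigma> \<ge> 0"
  shows gauss_avg_d\<mu>_eq: "gauss_avg_d\<mu> f \<mu> \<sigma> = gauss_mean (\<lambda>_. 1) g \<mu> \<sigma>"
    and gauss_avg_d\<sigma>_eq: "gauss_avg_d\<sigma> f \<mu> \<sigma> = gauss_mean (\<lambda>z. z) g \<mu> \<sigma>"
proof -
  show "gauss_avg_d\<mu> f \<mu> \<sigma> = gauss_mean (\<lambda>_. 1) g \<mu> \<sigma>"
    unfolding gauss_avg_d\<mu>_def
  proof (rule extend_halfplane_eq)
    show "deriv (\<lambda>m. gauss_avg f m s) m = gauss_mean (\<lambda>_. 1) g m s" if "s > 0" for m s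
      using gauss_mean_has_derivative_mean[OF f g] that
      by (simp add: gauss_avg_eq_gauss_mean DERIV_imp_deriv)
  qed (use g \<open>\<sigma> \<ge> 0\<close> in \<open>auto intro!: isCont_gauss_mean\<close>)
  show "gauss_avg_d\<sigma> f \<mu> \<sigma> = gauss_mean (\<lambda>z. z) g \<mu> \<sigma>"
    unfolding gauss_avg_d\<sigma>_def
  proof (rule extend_halfplane_eq)
    fix m s :: real assume "s > 0"
    \<comment> \<open>As functions of \<open>s\<close>, \<open>gauss_avg\<close> and
      \<open>gauss_mean\<close> are known to agree only for \<open>s > 0\<close>, so the derivative
      is transferred on that open half-line.\<close>
    have "((\<lambda>s. gauss_avg f m s) has_real_derivative gauss_mean (\<lambda>z. z) g m s) (at s)"
      using gauss_mean_has_derivative_sd[OF f g]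
      by (rule has_field_derivative_transform_within_open[where S = "{0<..}"])
        (use \<open>s > 0\<close> in \<open>auto simp: gauss_avg_eq_gauss_mean\<close>)
    then show "deriv (\<lambda>s. gauss_avg f m s) s = gauss_mean (\<lambda>z. z) g m s"
      by (rule DERIV_imp_deriv)
  qed (use g \<open>\<sigma> \<ge> 0\<close> in \<open>auto intro!: isCont_gauss_mean\<close>)
qed

text \<open>The left-hand side is \<open>E ((X - a) g(X))\<close>, the dissipation rate of \<open>V\<close>.\<close>

lemma gauss_mean_dissipation_pos:
  assumes g: "poly_growth g" "continuous_on UNIV g"
    and pos: "\<And>x. x \<noteq> a \<Longrightarrow> (x - a) * g x > 0"
    and ne: "\<mu> \<noteq> a \<or> \<sigma> \<noteq> 0"
  shows "(\<mu> - a) * gauss_mean (\<lambda>_. 1) g \<mu> \<sigma> + \<sigma> * gauss_mean (\<lambda>z. z) g \<mu> \<sigma> > 0"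
proof -
  let ?k = "\<lambda>z. (\<mu> + \<sigma> * z - a) * g (\<mu> + \<sigma> * z) * std_normal_density z"
  have i1: "integrable lborel (\<lambda>z. (\<mu> - a) * (1 * g (\<mu> + \<sigma> * z) * std_normal_density z))"
    by (intro integrable_mult_right integrable_gauss_mean g) auto
  have i2: "integrable lborel (\<lambda>z. \<sigma> * (z * g (\<mu> + \<sigma> * z) * std_normal_density z))"
    by (intro integrable_mult_right integrable_gauss_mean g) auto
  have k: "?k = (\<lambda>z. (\<mu> - a) * (1 * g (\<mu> + \<sigma> * z) * std_normal_density z)
      + \<sigma> * (z * g (\<mu> + \<sigma> * z) * std_normal_density z))"
    by (auto simp: algebra_simps)
  have int: "integrable lborel ?k"
    unfolding k using i1 i2 by (rule Bochner_Integration.integrable_add)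
  have eq: "(\<integral>z. ?k z \<partial>lborel)
      = (\<mu> - a) * gauss_mean (\<lambda>_. 1) g \<mu> \<sigma> + \<sigma> * gauss_mean (\<lambda>z. z) g \<mu> \<sigma>"
    unfolding k gauss_mean_def
    by (subst Bochner_Integration.integral_add[OF i1 i2]) (simp only: integral_mult_right_zero)
  have kpos: "?k z > 0" if "\<mu> + \<sigma> * z \<noteq> a" for z
    using pos[OF that] by (simp add: normal_density_pos)
  have nonneg: "?k z \<ge> 0" for z
    using kpos[of z] by (cases "\<mu> + \<sigma> * z = a") auto
  \<comment> \<open>A nonnegative integrand with integral 0 vanishes almost everywhere, but
    \<open>?k\<close> is positive off a single point, which is a null set.\<close>
  have "(\<integral>z. ?k z \<partial>lborel) \<noteq> 0"
  proof
    assume "(\<integral>z. ?k z \<partial>lborel) = 0"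
    then have k0: "AE z in lborel. ?k z = 0"
      using int nonneg by (subst (asm) integral_nonneg_eq_0_iff_AE) auto
    \<comment> \<open>If \<sigma> = 0, the quotient is 0 by convention; this is harmless, as then
      \<mu> differs from \<open>a\<close> and \<open>?k\<close> vanishes nowhere.\<close>
    have "?k z \<noteq> 0" if "z \<noteq> (a - \<mu>) / \<sigma>" for z
    proof -
      have "\<mu> + \<sigma> * z \<noteq> a"
        using ne that by (cases "\<sigma> = 0") (auto simp: field_simps)
      from kpos[OF this] show ?thesis by (rule less_imp_neq[symmetric])
    qed
    then have "AE z in lborel. ?k z = 0 \<longrightarrow> z = (a - \<mu>) / \<sigma>"
      by (intro AE_I2) blast
    from AE_mp[OF k0 this] have "AE z in lborel. z = (a - \<mu>) / \<sigma>" .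
    from AE_mp[OF this, where Q = "\<lambda>_. False"] AE_lborel_singleton[of "(a - \<mu>) / \<sigma>"]
    show False
      by (simp add: eventually_False ae_filter_eq_bot_iff)
  qed
  moreover have "(\<integral>z. ?k z \<partial>lborel) \<ge> 0"
    using nonneg by (intro Bochner_Integration.integral_nonneg) auto
  ultimately show ?thesis using eq by simp
qed

section \<open>The Lyapunov argument\<close>

text \<open>If V stayed above some \<epsilon> > 0, the path would remain in a compact set on which W
  has a positive minimum, and V would fall at least linearly, below 0. So V becomes arbitrarily
  small, and being nonincreasing it stays small.\<close>

lemma lyapunov_tendsto_zero:
  fixes V :: "'a::topological_space \<Rightarrow> real" and \<gamma> :: "real \<Rightarrow> 'a"
  assumes der: "\<And>t. t \<ge> 0 \<Longrightarrow> ((\<lambda>t. V (\<gamma> t)) has_real_derivative - W (\<gamma> t)) (at t within {0..})"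
    and W: "continuous_on UNIV W" "\<And>p. W p \<ge> 0" "\<And>p. V p > 0 \<Longrightarrow> W p > 0"
    and V: "\<And>p. V p \<ge> 0" "\<And>\<epsilon> K. compact {p. \<epsilon> \<le> V p \<and> V p \<le> K}"
  shows "((\<lambda>t. V (\<gamma> t)) \<longlongrightarrow> 0) at_top"
proof -
  \<comment> \<open>Used twice: \<open>c = 0\<close> gives monotonicity, and the minimum of W gives
    linear decay. Derivatives are needed only inside the interval, where they are two-sided; the
    endpoints are handled by continuity.\<close>
  have decr: "V (\<gamma> b) + c * b \<le> V (\<gamma> a) + c * a"
    if ab: "0 \<le> a" "a \<le> b" and c: "\<And>t. a < t \<Longrightarrow> t < b \<Longrightarrow> c \<le> W (\<gamma> t)" for a b c
  proof (rule DERIV_nonpos_imp_decreasing_open[OF ab(2)])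
    fix t assume t: "a < t" "t < b"
    have "at t within {0..} = at t"
      using ab t by (intro at_within_interior) (auto simp: interior_real_atLeast)
    then have "((\<lambda>t. V (\<gamma> t)) has_real_derivative - W (\<gamma> t)) (at t)"
      using der[of t] ab t by simp
    then have "((\<lambda>t. V (\<gamma> t) + c * t) has_real_derivative - W (\<gamma> t) + c) (at t)"
      by (auto intro!: derivative_eq_intros)
    then show "\<exists>y. ((\<lambda>t. V (\<gamma> t) + c * t) has_real_derivative y) (at t) \<and> y \<le> 0"
      using c[OF t] by fastforce
  next
    have "continuous_on {0..} (\<lambda>t. V (\<gamma> t))"
      using der by (intro DERIV_continuous_on) auto
    then show "continuous_on {a..b} (\<lambda>t. V (\<gamma> t) + c * t)"
      using ab by (intro continuous_intros) (auto elim: continuous_on_subset)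
  qed
  have mono: "V (\<gamma> b) \<le> V (\<gamma> a)" if "0 \<le> a" "a \<le> b" for a b
    using decr[OF that, of 0] W(2) by simp
  have ex: "\<exists>T\<ge>0. V (\<gamma> T) < \<epsilon>" if \<epsilon>: "\<epsilon> > 0" for \<epsilon>
  proof (rule ccontr)
    assume "\<not> ?thesis"
    then have ge: "\<epsilon> \<le> V (\<gamma> t)" if "t \<ge> 0" for t using that by force
    let ?K = "{p. \<epsilon> \<le> V p \<and> V p \<le> V (\<gamma> 0)}"
    have in_K: "\<gamma> t \<in> ?K" if "t \<ge> 0" for t using ge mono[of 0 t] that by auto
    then have "?K \<noteq> {}" by blast
    then obtain p where p: "p \<in> ?K" "\<And>q. q \<in> ?K \<Longrightarrow> W p \<le> W q"
      using continuous_attains_inf[OF V(2) _ continuous_on_subset[OF W(1)], of \<epsilon> "V (\<gamma> 0)"] by blast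
    have c: "W p > 0" using p(1) \<epsilon> W(3) by force
    \<comment> \<open>At this time the guaranteed loss \<open>W p * b\<close> is
      \<open>V (\<gamma> 0) + 1\<close>, which would leave V at most -1.\<close>
    define b where "b = (V (\<gamma> 0) + 1) / W p"
    have b: "0 \<le> b" using c V(1) by (simp add: b_def add_nonneg_nonneg)
    have "V (\<gamma> b) + W p * b \<le> V (\<gamma> 0) + W p * 0"
      using b p(2) in_K by (intro decr) auto
    then show False using V(1)[of "\<gamma> b"] c by (simp add: b_def)
  qed
  show ?thesis
  proof (rule tendstoI)
    fix \<epsilon> :: real assume "\<epsilon> > 0"
    then obtain T where T: "T \<ge> 0" "V (\<gamma> T) < \<epsilon>" using ex by blast
    show "\<forall>\<^sub>F t in at_top. dist (V (\<gamma> t)) 0 < \<epsilon>"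
      using eventually_ge_at_top[of T]
      by eventually_elim (use T mono V(1) in \<open>simp add: le_less_trans[OF mono]\<close>)
  qed
qed

section \<open>The minimizer and convergence of the flow\<close>

lemma coercive_attains_min:
  fixes f :: "real \<Rightarrow> real"
  assumes "continuous_on UNIV f" "filterlim f at_top at_infinity"
  obtains a where "\<And>x. f a \<le> f x"
proof -
  have "\<forall>\<^sub>F x in at_infinity. f x \<ge> f 0"
    using assms(2) by (simp add: filterlim_at_top)
  then obtain b where b: "\<And>x. \<bar>x\<bar> \<ge> b \<Longrightarrow> f 0 \<le> f x"
    by (auto simp: eventually_at_infinity)
  \<comment> \<open>The radius \<open>\<bar>b\<bar>\<close> is nonnegative, so the ball contains 0;
    outside it, \<open>f x\<close> is at least \<open>f 0\<close> and hence at least the minimum on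
    the ball.\<close>
  have "\<exists>a\<in>cball 0 \<bar>b\<bar>. \<forall>x\<in>cball 0 \<bar>b\<bar>. f a \<le> f x"
    by (intro continuous_attains_inf continuous_on_subset[OF assms(1)]) auto
  then obtain a where a: "\<And>x. \<bar>x\<bar> \<le> \<bar>b\<bar> \<Longrightarrow> f a \<le> f x" by (auto simp: Ball_def)
  have "f a \<le> f x" for x
    using a[of x] a[of 0] b[of x] by (cases "\<bar>x\<bar> \<le> \<bar>b\<bar>") linarith+
  then show ?thesis by (rule that)
qed

theorem proposition2p11:
  fixes f \<mu> \<sigma> :: "real \<Rightarrow> real"
  assumes "f \<in> C_poly 2"
    and "filterlim f at_top at_infinity"
    and "strictly_convex f"
    and "gradient_flow f \<mu> \<sigma>"
  shows "\<exists>xbar. (\<forall>x. is_arg_min f (\<lambda>_. True) x \<longleftrightarrow> x = xbar) \<and> (\<mu> \<longlongrightarrow> xbar) at_top"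
proof -
  define g where "g = deriv f"
  have C: "\<And>j x. j < 2 \<Longrightarrow> (deriv ^^ j) f differentiable (at x)"
    "\<And>j. j \<le> 2 \<Longrightarrow> continuous_on UNIV ((deriv ^^ j) f)"
    "\<And>j. j \<le> 2 \<Longrightarrow> poly_growth ((deriv ^^ j) f)"
    using assms(1) unfolding C_poly_def by (blast intro: poly_growthI_tendsto)+
  have f: "poly_growth f" "continuous_on UNIV f" "\<And>x. (f has_real_derivative g x) (at x)"
    using C(1)[of 0] C(2)[of 0] C(3)[of 0] by (auto simp: g_def DERIV_deriv_iff_real_differentiable)
  have g: "poly_growth g" "continuous_on UNIV g" "\<And>x. (g has_real_derivative deriv g x) (at x)"
    using C(1)[of 1] C(2)[of 1] C(3)[of 1] by (auto simp: g_def DERIV_deriv_iff_real_differentiable)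
  have g'_pos: "deriv g x > 0" for x
    using assms(3) by (simp add: strictly_convex_def g_def numeral_2_eq_2)
  have g_mono: "g x < g y" if "x < y" for x y
    using DERIV_pos_imp_increasing[OF that] g(3) g'_pos by blast
  obtain a where a: "\<And>x. f a \<le> f x"
    using coercive_attains_min[OF f(2) assms(2)] by blast
  have crit: "g x = 0" if "\<And>y. f x \<le> f y" for x
    using DERIV_local_min[OF f(3), of 1 x] that by simp
  \<comment> \<open>The strictly increasing \<open>g\<close> vanishes at \<open>a\<close>, so it has
    the sign of \<open>x - a\<close>. Any other minimizer would be a further zero of
    \<open>g\<close>.\<close>
  have sgn: "(x - a) * g x > 0" if "x \<noteq> a" for x
    using that g_mono[of x a] g_mono[of a x] crit[OF a]
    by (cases "x < a") (auto intro: mult_neg_neg mult_pos_pos)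
  have uniq: "x = a" if "\<And>y. f x \<le> f y" for x
    using sgn[of x] crit[OF that] by auto
  have argmin: "is_arg_min f (\<lambda>_. True) x \<longleftrightarrow> x = a" for x
    unfolding is_arg_min_linorder using a uniq by blast

  let ?G1 = "gauss_mean (\<lambda>_. 1) g" and ?G2 = "gauss_mean (\<lambda>z. z) g"
  define V where "V p = ((fst p - a)\<^sup>2 + (snd p)\<^sup>2) / 2" for p :: "real \<times> real"
  \<comment> \<open>By the chain rule this is -V' along the flow. It is defined on the whole plane,
    with \<sigma> < 0 included, so compact annuli need no cut at the boundary.\<close>
  define W where "W p = (fst p - a) * ?G1 (fst p) (snd p) + snd p * ?G2 (fst p) (snd p)"
    for p :: "real \<times> real"
  have flow: "\<sigma> t \<ge> 0" "(\<mu> has_real_derivative - ?G1 (\<mu> t) (\<sigma> t)) (at t within {0..})"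
    "(\<sigma> has_real_derivative - ?G2 (\<mu> t) (\<sigma> t)) (at t within {0..})" if "t \<ge> 0" for t
    using assms(4) that gauss_avg_d\<mu>_eq[OF f g(1,2)] gauss_avg_d\<sigma>_eq[OF f g(1,2)]
    by (auto simp: gradient_flow_def)
  have V_iff: "V p > 0 \<longleftrightarrow> fst p \<noteq> a \<or> snd p \<noteq> 0" for p
    by (simp add: V_def sum_power2_gt_zero_iff)
  have "((\<lambda>t. V (\<mu> t, \<sigma> t)) \<longlongrightarrow> 0) at_top"
  proof (rule lyapunov_tendsto_zero[where W = W])
    show "((\<lambda>t. V (\<mu> t, \<sigma> t)) has_real_derivative - W (\<mu> t, \<sigma> t)) (at t within {0..})"
      if "t \<ge> 0" for t
      unfolding V_def W_def using flow(2,3)[OF that]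
      by (auto intro!: derivative_eq_intros simp: field_simps)
    have "isCont W p" for p
      unfolding W_def
      using isCont_gauss_mean[OF g(1,2), of "\<lambda>_. 1" "fst p" "snd p"]
        isCont_gauss_mean[OF g(1,2), of "\<lambda>z. z" "fst p" "snd p"]
      by (intro continuous_intros) auto
    then show "continuous_on UNIV W" by (simp add: continuous_on_eq_continuous_at)
    show W_pos: "W p > 0" if "V p > 0" for p
      unfolding W_def using that V_iff by (intro gauss_mean_dissipation_pos g sgn) auto
    \<comment> \<open>Where V is 0, both coefficients \<open>fst p - a\<close> and
      \<open>snd p\<close> are 0, so W is 0 as well.\<close>
    show "W p \<ge> 0" for p
      using W_pos[of p] V_iff[of p] by (cases "V p > 0") (auto simp: W_def)
    show "V p \<ge> 0" for p by (simp add: V_def)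
    fix \<epsilon> K
    have V_cont: "continuous_on UNIV V" unfolding V_def by (intro continuous_intros) auto
    \<comment> \<open>Half the squared distance to \<open>(a, 0)\<close>: sublevel sets lie in balls
      of radius \<open>sqrt (2 * K)\<close>.\<close>
    have "V p = (dist p (a, 0))\<^sup>2 / 2" for p
      by (cases p) (simp add: V_def dist_prod_def dist_real_def)
    then have "(dist (a, 0) p)\<^sup>2 \<le> 2 * K" if "V p \<le> K" for p
      using that by (metis dist_commute field_sum_of_halves mult_2 add_mono)
    then have "dist (a, 0) p \<le> sqrt (2 * K)" if "V p \<le> K" for p
      using that by (blast intro: real_le_rsqrt)
    then have "{p. \<epsilon> \<le> V p \<and> V p \<le> K} \<subseteq> cball (a, 0) (sqrt (2 * K))"
      by auto
    then have "bounded {p. \<epsilon> \<le> V p \<and> V p \<le> K}"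
      by (rule bounded_subset[OF bounded_cball])
    moreover have "closed {p. \<epsilon> \<le> V p \<and> V p \<le> K}"
      by (intro closed_Collect_conj closed_Collect_le V_cont continuous_intros)
    ultimately show "compact {p. \<epsilon> \<le> V p \<and> V p \<le> K}"
      by (simp add: compact_eq_bounded_closed)
  qed
  then have "((\<lambda>t. sqrt (2 * V (\<mu> t, \<sigma> t))) \<longlongrightarrow> sqrt (2 * 0)) at_top"
    by (intro tendsto_intros)
  then have lim: "((\<lambda>t. sqrt (2 * V (\<mu> t, \<sigma> t))) \<longlongrightarrow> 0) at_top" by simp
  \<comment> \<open>\<open>sqrt (2 * V p)\<close> is the distance of \<open>p\<close> to
    \<open>(a, 0)\<close>, which bounds its first coordinate.\<close>
  have "norm (\<mu> t - a) \<le> sqrt (2 * V (\<mu> t, \<sigma> t))" for t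
    by (simp add: V_def real_le_rsqrt)
  then have "((\<lambda>t. \<mu> t - a) \<longlongrightarrow> 0) at_top"
    by (rule Lim_null_comparison[OF always_eventually[OF allI] lim])
  then have "(\<mu> \<longlongrightarrow> a) at_top" by (simp add: LIM_zero_iff)
  with argmin show ?thesis by blast
qed

end
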